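(* Every free group $F$ is subgroup into-conjugacy separable; that is, for any two finitely generated subgroups $H_1,H_2\leqslant F$ such that $H_2$ is not conjugate into $H_1$ in $F$, there exists a homomorphism $\phi$ from $F$ to a finite group $\overline{G}$ such that $\phi(H_2)$ is not conjugate into $\phi(H_1)$ in $\overline{G}$.
   Context: For two subgroups $A,B$ of a group $G$, $A$ is said to be conjugate into $B$ (in $G$) if there is $g\in G$ such that $A^g$ is a subgroup of $B$, where $A^g$ denotes the conjugate of $A$ by $g$. The free group is of arbitrary rank. *)

theory Defs
  imports "HOL-Algebra.Generated_Groups"
begin

section \<open>Free groups of arbitrary rank\<close>

text \<open>A letter \<open>(x, True)\<close> stands for \<open>x\<close> and \<open>(x, False)\<close> for its formal inverse.\<close>

type_synonym 'x letter = "'x \<times> bool"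

fun inv_letter :: "'x letter \<Rightarrow> 'x letter" where
  "inv_letter (x, b) = (x, \<not> b)"

definition reduced :: "'x letter list \<Rightarrow> bool" where
  "reduced w \<longleftrightarrow> (\<forall>i. Suc i < length w \<longrightarrow> w ! Suc i \<noteq> inv_letter (w ! i))"

fun push :: "'x letter \<Rightarrow> 'x letter list \<Rightarrow> 'x letter list" where
  "push a [] = [a]"
| "push a (b # w) = (if b = inv_letter a then w else a # b # w)"

text \<open>For reduced \<open>u\<close> and \<open>v\<close>, \<open>foldr push u v\<close> is the reduced form of the concatenation
  \<open>u @ v\<close>: prepending a letter to a reduced word allows at most one cancellation.\<close>

definition free_group :: "'x set \<Rightarrow> 'x letter list monoid" where
  "free_group X = \<lparr> carrier = {w. reduced w \<and> fst ` set w \<subseteq> X},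
                    monoid.mult = foldr push, one = [] \<rparr>"

text \<open>The alphabet may be taken inside the element type of \<open>F\<close>, since a basis is a subset of the
  carrier; see \<open>is_free_groupI\<close> below for arbitrary alphabets.\<close>

definition is_free_group :: "('a, 'b) monoid_scheme \<Rightarrow> bool" where
  "is_free_group F \<longleftrightarrow> group F \<and> (\<exists>X :: 'a set. F \<cong> free_group X)"


section \<open>Into-conjugacy separability\<close>

definition fin_gen_subgroup :: "('a, 'b) monoid_scheme \<Rightarrow> 'a set \<Rightarrow> bool" where
  "fin_gen_subgroup G H \<longleftrightarrow> (\<exists>S. finite S \<and> S \<subseteq> carrier G \<and> H = generate G S)"

text \<open>\<open>A\<^sup>g = g\<^sup>-\<^sup>1 A g\<close>; with the other convention \<open>conjugate_into\<close> below would be the same relation.\<close>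

definition conj_set :: "('a, 'b) monoid_scheme \<Rightarrow> 'a set \<Rightarrow> 'a \<Rightarrow> 'a set" where
  "conj_set G A g = (inv\<^bsub>G\<^esub> g <#\<^bsub>G\<^esub> A) #>\<^bsub>G\<^esub> g"

text \<open>Meant for subgroups \<open>A\<close> and \<open>B\<close> of a group \<open>G\<close>; then \<open>conj_set G A g\<close> is a subgroup
  of \<open>G\<close>, hence a subgroup of \<open>B\<close> as soon as it is contained in \<open>B\<close>.\<close>

definition conjugate_into :: "('a, 'b) monoid_scheme \<Rightarrow> 'a set \<Rightarrow> 'a set \<Rightarrow> bool" where
  "conjugate_into G A B \<longleftrightarrow> (\<exists>g \<in> carrier G. conj_set G A g \<subseteq> B)"

text \<open>Every finite group has an isomorphic copy with carrier in \<^typ>\<open>nat\<close>, so restricting the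
  element type of the finite group \<open>Q\<close> loses nothing; see \<open>finite_quotient_nat\<close> below.\<close>

definition subgroup_into_conjugacy_separable :: "('a, 'b) monoid_scheme \<Rightarrow> bool" where
  "subgroup_into_conjugacy_separable G \<longleftrightarrow>
     (\<forall>H\<^sub>1 H\<^sub>2. subgroup H\<^sub>1 G \<and> fin_gen_subgroup G H\<^sub>1 \<and> subgroup H\<^sub>2 G \<and> fin_gen_subgroup G H\<^sub>2
        \<and> \<not> conjugate_into G H\<^sub>2 H\<^sub>1 \<longrightarrow>
        (\<exists>(Q :: nat monoid) \<phi>. group Q \<and> finite (carrier Q) \<and> \<phi> \<in> hom G Q
           \<and> \<not> conjugate_into Q (\<phi> ` H\<^sub>2) (\<phi> ` H\<^sub>1)))"


section \<open>Adequacy of the definitions\<close>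

lemma inv_letter_invol [simp]: "inv_letter (inv_letter a) = a"
  by (cases a) auto

lemma inv_letter_neq [simp]: "inv_letter a \<noteq> a" "a \<noteq> inv_letter a"
  by (cases a; auto)+

lemma fst_inv_letter [simp]: "fst (inv_letter a) = fst a"
  by (cases a) auto

lemma reduced_Nil [simp]: "reduced []" 
  by (simp add: reduced_def)

lemma reduced_single [simp]: "reduced [a]"
  by (simp add: reduced_def)

lemma reduced_Cons_Cons [simp]:
  "reduced (a # b # w) \<longleftrightarrow> b \<noteq> inv_letter a \<and> reduced (b # w)"
  unfolding reduced_def by (auto simp: nth_Cons split: nat.splits)

lemma reduced_tl: "reduced (a # w) \<Longrightarrow> reduced w"
  by (cases w) auto

lemma reduced_push: "reduced w \<Longrightarrow> reduced (push a w)"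
  by (cases w) (auto dest: reduced_tl)

lemma push_inv: "reduced w \<Longrightarrow> push (inv_letter a) (push a w) = w"
proof (cases w)
  case (Cons b v)
  assume "reduced w"
  then show ?thesis using Cons by (cases v) auto
qed simp

lemma push_reduced: "reduced (a # w) \<Longrightarrow> push a w = a # w"
  by (cases w) auto

lemma reduced_foldr: "reduced v \<Longrightarrow> reduced (foldr push u v)"
  by (induction u) (auto intro: reduced_push)

lemma set_push: "set (push a w) \<subseteq> insert a (set w)"
  by (cases w) auto

lemma set_foldr: "set (foldr push u v) \<subseteq> set u \<union> set v"
  by (induction u) (use set_push in fastforce)+

lemma foldr_push: "reduced w \<Longrightarrow> foldr push (push a u) w = push a (foldr push u w)"
proof (cases u)
  case (Cons b v)
  assume "reduced w"
  then have "b = inv_letter a \<Longrightarrow> push a (push b (foldr push v w)) = foldr push v w"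
    using push_inv[of "foldr push v w" "inv_letter a"] by (simp add: reduced_foldr)
  then show ?thesis using Cons by auto
qed simp

lemma foldr_foldr: "reduced w \<Longrightarrow> foldr push (foldr push u v) w = foldr push u (foldr push v w)"
  by (induction u) (auto simp: foldr_push)

lemma foldr_Nil: "reduced w \<Longrightarrow> foldr push w [] = w"
proof (induction w)
  case (Cons a w)
  then show ?case using reduced_tl[of a w] push_reduced[of a w] by simp
qed simp

lemma foldr_inverse: "reduced v \<Longrightarrow> foldr push (map inv_letter (rev u)) (foldr push u v) = v"
  by (induction u) (auto simp: push_inv reduced_foldr)

theorem group_free_group: "group (free_group X)"
proof (rule groupI)
  fix u v w assume "u \<in> carrier (free_group X)" "v \<in> carrier (free_group X)"
  then show "u \<otimes>\<^bsub>free_group X\<^esub> v \<in> carrier (free_group X)"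
    using set_foldr[of u v] by (auto simp: free_group_def reduced_foldr) force
  assume "w \<in> carrier (free_group X)"
  then show "u \<otimes>\<^bsub>free_group X\<^esub> v \<otimes>\<^bsub>free_group X\<^esub> w = u \<otimes>\<^bsub>free_group X\<^esub> (v \<otimes>\<^bsub>free_group X\<^esub> w)"
    by (auto simp: free_group_def foldr_foldr)
next
  fix u assume u: "u \<in> carrier (free_group X)"
  let ?v = "foldr push (map inv_letter (rev u)) []"
  have "?v \<in> carrier (free_group X)"
    using u set_foldr[of "map inv_letter (rev u)" "[]"] 
    by (force simp: free_group_def reduced_foldr)
  moreover have "?v \<otimes>\<^bsub>free_group X\<^esub> u = \<one>\<^bsub>free_group X\<^esub>"
    using u foldr_inverse[of "[]" u] by (simp add: free_group_def foldr_foldr foldr_Nil)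
  ultimately show "\<exists>v \<in> carrier (free_group X). v \<otimes>\<^bsub>free_group X\<^esub> u = \<one>\<^bsub>free_group X\<^esub>" by blast
qed (auto simp: free_group_def)

fun eval_letter :: "('g, 'b) monoid_scheme \<Rightarrow> ('x \<Rightarrow> 'g) \<Rightarrow> 'x letter \<Rightarrow> 'g" where
  "eval_letter G f (x, b) = (if b then f x else inv\<^bsub>G\<^esub> f x)"

definition eval_word :: "('g, 'b) monoid_scheme \<Rightarrow> ('x \<Rightarrow> 'g) \<Rightarrow> 'x letter list \<Rightarrow> 'g" where
  "eval_word G f w = foldr (\<lambda>a z. eval_letter G f a \<otimes>\<^bsub>G\<^esub> z) w \<one>\<^bsub>G\<^esub>"

text \<open>The universal property: existence and uniqueness of the extension of a map on the basis.\<close>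

theorem free_group_extension:
  assumes "group G" and f: "f \<in> X \<rightarrow> carrier G"
  shows "eval_word G f \<in> hom (free_group X) G"
    and "x \<in> X \<Longrightarrow> eval_word G f [(x, True)] = f x"
    and "\<lbrakk>h \<in> hom (free_group X) G; \<And>x. x \<in> X \<Longrightarrow> h [(x, True)] = f x; w \<in> carrier (free_group X)\<rbrakk>
           \<Longrightarrow> h w = eval_word G f w"
proof -
  interpret group G by fact
  interpret F: group "free_group X" by (rule group_free_group)
  have letter: "eval_letter G f a \<in> carrier G" if "fst a \<in> X" for a
    using f that by (cases a) auto
  have cl: "eval_word G f w \<in> carrier G" if "fst ` set w \<subseteq> X" for w
    using that by (induction w) (auto simp: eval_word_def letter)
  have letter_inv: "eval_letter G f a \<otimes>\<^bsub>G\<^esub> (eval_letter G f (inv_letter a) \<otimes>\<^bsub>G\<^esub> z) = z"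
    if "fst a \<in> X" "z \<in> carrier G" for a z
  proof -
    obtain x b where a: "a = (x, b)" by (cases a)
    then have "f x \<in> carrier G" using f that by auto
    then show ?thesis using that a by (simp add: m_assoc[symmetric])
  qed
  have push: "eval_word G f (push a w) = eval_letter G f a \<otimes>\<^bsub>G\<^esub> eval_word G f w"
    if "fst a \<in> X" "fst ` set w \<subseteq> X" for a w
  proof (cases w)
    case (Cons b v)
    then show ?thesis
      using that letter_inv[of a "eval_word G f v"] cl[of v] by (auto simp: eval_word_def)
  qed (use that in \<open>simp add: eval_word_def\<close>)
  have mult: "eval_word G f (foldr push u v) = eval_word G f u \<otimes>\<^bsub>G\<^esub> eval_word G f v"
    if "fst ` set u \<subseteq> X" "fst ` set v \<subseteq> X" for u v
    using that
  proof (induction u)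
    case Nil
    then show ?case using cl[of v] by (simp add: eval_word_def)
  next
    case (Cons a u)
    have "fst ` set (foldr push u v) \<subseteq> X"
      using Cons.prems set_foldr[of u v] by force
    then show ?case
      using Cons letter[of a] cl[of u] cl[of v] push[of a "foldr push u v"]
      by (auto simp: m_assoc eval_word_def)
  qed
  show "eval_word G f \<in> hom (free_group X) G"
    using cl mult by (auto simp: hom_def free_group_def)
  show "x \<in> X \<Longrightarrow> eval_word G f [(x, True)] = f x"
    using letter[of "(x, True)"] by (simp add: eval_word_def)
  assume h: "h \<in> hom (free_group X) G" and hx: "\<And>x. x \<in> X \<Longrightarrow> h [(x, True)] = f x"
    and w: "w \<in> carrier (free_group X)"
  interpret h: group_hom "free_group X" G h
    by (intro group_hom.intro group_hom_axioms.intro h group_axioms group_free_group)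
  have hl: "h [a] = eval_letter G f a" if "fst a \<in> X" for a
  proof -
    obtain x b where a: "a = (x, b)" by (cases a)
    have "inv\<^bsub>free_group X\<^esub> [(x, True)] = [(x, False)]"
      using that a by (intro F.inv_equality) (auto simp: free_group_def)
    moreover have "[(x, True)] \<in> carrier (free_group X)"
      using that a by (auto simp: free_group_def)
    ultimately show ?thesis
      using hx[of x] h.hom_inv[of "[(x, True)]"] that a by (cases b) auto
  qed
  show "h w = eval_word G f w"
    using w
  proof (induction w)
    case Nil
    then show ?case using h.hom_one by (simp add: eval_word_def free_group_def)
  next
    case (Cons a w)
    then have *: "[a] \<in> carrier (free_group X)" "w \<in> carrier (free_group X)" "fst a \<in> X"
      by (auto simp: free_group_def dest: reduced_tl)
    have "a # w = [a] \<otimes>\<^bsub>free_group X\<^esub> w"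
      using Cons.prems by (simp add: free_group_def push_reduced)
    then have "h (a # w) = h [a] \<otimes>\<^bsub>G\<^esub> h w"
      using * h.hom_mult by metis
    then show ?case using * Cons.IH hl by (simp add: eval_word_def)
  qed
qed

lemma free_group_rename:
  assumes "inj_on g X"
  shows "free_group X \<cong> free_group (g ` X)"
proof -
  define l where "l = map_prod g (id :: bool \<Rightarrow> bool)"
  let ?m = "map l"
  have fst_l [simp]: "fst (l a) = g (fst a)" for a by (simp add: l_def)
  have inv: "inv_letter (l a) = l (inv_letter a)" for a by (cases a) (auto simp: l_def)
  have l_eq: "l a = l b \<longleftrightarrow> a = b" if "fst a \<in> X" "fst b \<in> X" for a b
    using that assms by (cases a; cases b) (auto simp: l_def dest: inj_onD)
  have red: "reduced (?m w) \<longleftrightarrow> reduced w" if "fst ` set w \<subseteq> X" for w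
    using that
  proof (induction w rule: induct_list012)
    case (3 a b w)
    then show ?case using l_eq[of b "inv_letter a"] by (auto simp: inv)
  qed auto
  have push: "?m (push a w) = push (l a) (?m w)" if "fst a \<in> X" "fst ` set w \<subseteq> X" for a w
    using that l_eq[of "hd w" "inv_letter a"] by (cases w) (auto simp: inv)
  have mult: "?m (foldr push u v) = foldr push (?m u) (?m v)"
    if "fst ` set u \<subseteq> X" "fst ` set v \<subseteq> X" for u v
    using that
  proof (induction u)
    case (Cons a u)
    then have "fst ` set (foldr push u v) \<subseteq> X"
      using set_foldr[of u v] by force
    then show ?case using Cons push by auto
  qed auto
  have inj_on_l: "inj_on l {a. fst a \<in> X}"
    using l_eq by (auto intro!: inj_onI simp del: split_paired_All)
  have "inj_on ?m (carrier (free_group X))"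
  proof (rule inj_onI)
    fix u v assume "u \<in> carrier (free_group X)" "v \<in> carrier (free_group X)" "?m u = ?m v"
    then show "u = v"
      using inj_on_subset[OF inj_on_l, of "set u \<union> set v"] inj_on_map_eq_map[of l u v]
      by (auto simp: free_group_def)
  qed
  moreover have "?m ` carrier (free_group X) = carrier (free_group (g ` X))"
  proof
    show "?m ` carrier (free_group X) \<subseteq> carrier (free_group (g ` X))"
      using red by (fastforce simp: free_group_def)
    show "carrier (free_group (g ` X)) \<subseteq> ?m ` carrier (free_group X)"
    proof
      fix v assume v: "v \<in> carrier (free_group (g ` X))"
      define u where "u = map (map_prod (inv_into X g) (id :: bool \<Rightarrow> bool)) v"
      have m: "?m u = v"
        unfolding u_def l_def map_map
        by (rule map_idI) (use v in \<open>force simp: free_group_def f_inv_into_f map_prod_def\<close>)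
      have X: "fst ` set u \<subseteq> X"
      proof
        fix x assume "x \<in> fst ` set u"
        then obtain y b where "x = inv_into X g y" "(y, b) \<in> set v" by (auto simp: u_def)
        then show "x \<in> X" using v by (force simp: free_group_def intro: inv_into_into)
      qed
      then show "v \<in> ?m ` carrier (free_group X)"
        using m v red[OF X] by (force simp: free_group_def)
    qed
  qed
  ultimately have "?m \<in> iso (free_group X) (free_group (g ` X))"
    using mult by (auto simp: iso_def hom_def bij_betw_def) (auto simp: free_group_def)
  then show ?thesis by (rule is_isoI)
qed

theorem is_free_groupI:
  fixes F :: "('a, 'b) monoid_scheme" and X :: "'x set"
  assumes "group F" and "F \<cong> free_group X"
  shows "is_free_group F"
proof -
  from assms have "free_group X \<cong> F" by (metis group.iso_sym)
  then obtain h where h: "bij_betw h (carrier (free_group X)) (carrier F)"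
    by (auto simp: is_iso_def iso_def)
  have "inj_on (\<lambda>x. h [(x, True)]) X"
  proof (rule inj_onI)
    fix x y assume "x \<in> X" "y \<in> X" and eq: "h [(x, True)] = h [(y, True)]"
    then have "[(x, True)] \<in> carrier (free_group X)" "[(y, True)] \<in> carrier (free_group X)"
      by (auto simp: free_group_def)
    with eq h have "[(x, True)] = [(y, True)]" by (meson bij_betw_imp_inj_on inj_onD)
    then show "x = y" by simp
  qed
  from iso_trans[OF assms(2) free_group_rename[OF this]] show ?thesis
    using assms(1) by (auto simp: is_free_group_def)
qed

theorem finite_quotient_nat:
  fixes K :: "('k, 'c) monoid_scheme"
  assumes "group K" "finite (carrier K)" and f: "f \<in> hom G K"
    and A: "A \<subseteq> carrier G" and B: "B \<subseteq> carrier G"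
    and nc: "\<not> conjugate_into K (f ` A) (f ` B)"
  shows "\<exists>(Q :: nat monoid) \<phi>. group Q \<and> finite (carrier Q) \<and> \<phi> \<in> hom G Q
           \<and> \<not> conjugate_into Q (\<phi> ` A) (\<phi> ` B)"
proof -
  interpret K: group K by fact
  obtain e :: "'k \<Rightarrow> nat" where e: "inj_on e (carrier K)"
    using assms(2) finite_imp_inj_to_nat_seg by metis
  define d where "d = inv_into (carrier K) e"
  have d: "d (e x) = x" if "x \<in> carrier K" for x
    using that e by (simp add: d_def)
  define Q :: "nat monoid" where
    "Q = \<lparr> carrier = e ` carrier K, monoid.mult = \<lambda>x y. e (d x \<otimes>\<^bsub>K\<^esub> d y), one = e \<one>\<^bsub>K\<^esub> \<rparr>"
  have Q: "group Q"
  proof (rule groupI)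
    fix x assume "x \<in> carrier Q"
    then obtain k where "k \<in> carrier K" "x = e k" by (auto simp: Q_def)
    then show "\<exists>y\<in>carrier Q. y \<otimes>\<^bsub>Q\<^esub> x = \<one>\<^bsub>Q\<^esub>"
      by (intro bexI[of _ "e (inv\<^bsub>K\<^esub> k)"]) (auto simp: Q_def d)
  qed (auto simp: Q_def d K.m_assoc)
  interpret Q: group Q by fact
  have inv: "inv\<^bsub>Q\<^esub> (e k) = e (inv\<^bsub>K\<^esub> k)" if "k \<in> carrier K" for k
    using that by (intro Q.inv_equality) (auto simp: Q_def d)
  have fc: "f x \<in> carrier K" if "x \<in> carrier G" for x
    using f that by (auto simp: hom_def)
  have hom: "e \<circ> f \<in> hom G Q"
    using f by (auto simp: hom_def Q_def d fc)
  have "conjugate_into K (f ` A) (f ` B)" if "conjugate_into Q ((e \<circ> f) ` A) ((e \<circ> f) ` B)"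
  proof -
    from that obtain k where k: "k \<in> carrier K"
      and sub: "conj_set Q ((e \<circ> f) ` A) (e k) \<subseteq> (e \<circ> f) ` B"
      by (auto simp: conjugate_into_def Q_def)
    have "conj_set K (f ` A) k \<subseteq> f ` B"
    proof
      fix y assume "y \<in> conj_set K (f ` A) k"
      then obtain a where a: "a \<in> A" "y = inv\<^bsub>K\<^esub> k \<otimes>\<^bsub>K\<^esub> f a \<otimes>\<^bsub>K\<^esub> k"
        by (auto simp: conj_set_def l_coset_def r_coset_def)
      then have fa: "f a \<in> carrier K" using A fc by auto
      then have y: "y \<in> carrier K" using a k by auto
      have "e y = inv\<^bsub>Q\<^esub> (e k) \<otimes>\<^bsub>Q\<^esub> e (f a) \<otimes>\<^bsub>Q\<^esub> e k"
        using a k fa by (simp add: inv) (simp add: Q_def d)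
      then have "e y \<in> conj_set Q ((e \<circ> f) ` A) (e k)"
        using a by (auto simp: conj_set_def l_coset_def r_coset_def)
      then obtain b where "b \<in> B" "e y = e (f b)" using sub by auto
      then show "y \<in> f ` B" using B fc y e by (auto dest!: inj_onD)
    qed
    then show ?thesis using k by (auto simp: conjugate_into_def)
  qed
  moreover have "finite (carrier Q)" using assms(2) by (simp add: Q_def)
  ultimately show ?thesis using Q hom nc by blast
qed

end

theory Submission
  imports Defs "HOL-Combinatorics.Permutations"
begin

text \<open>It suffices to find a finite \<open>F\<close>-set \<open>Y\<close> with a point fixed by \<open>H\<^sub>1\<close> and none fixed by \<open>H\<^sub>2\<close>:
  then \<open>H\<^sub>2\<close> is not conjugate into \<open>H\<^sub>1\<close> in the symmetric group of \<open>Y\<close>. Take the finite set \<open>P\<close> of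
  cosets of \<open>H\<^sub>1\<close> visited by the generators of \<open>H\<^sub>1\<close>. For every edge of the Schreier graph that
  leaves \<open>P\<close>, insert a copy of a finite Cayley graph of large girth, cut open at one edge. A short
  nontrivial word fixing a point of \<open>Y\<close> must pass through \<open>P\<close>, and a short reduced word leading
  from \<open>P\<close> to \<open>P\<close> never enters a copy, since it could not come out again. So if the generators of
  \<open>H\<^sub>2\<close> fix a point of \<open>Y\<close>, then a conjugate of \<open>H\<^sub>2\<close> fixes a coset in \<open>P\<close>, that is, \<open>H\<^sub>2\<close> is
  conjugate into \<open>H\<^sub>1\<close>.\<close>

section \<open>Permutation groups and words\<close>

text \<open>Elements are total functions that are the identity off \<open>S\<close>, so the product
  is plain composition, the unit is \<open>id\<close> and the inverse is
  \<open>inv_into UNIV\<close>.\<close>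

definition perm_group :: "'s set \<Rightarrow> ('s \<Rightarrow> 's) monoid" where
  "perm_group S = \<lparr> carrier = {p. p permutes S}, monoid.mult = (\<circ>), one = id \<rparr>"

lemma group_perm_group: "group (perm_group S)"
proof (rule groupI)
  fix p assume "p \<in> carrier (perm_group S)"
  then show "\<exists>q \<in> carrier (perm_group S). q \<otimes>\<^bsub>perm_group S\<^esub> p = \<one>\<^bsub>perm_group S\<^esub>"
    by (intro bexI[of _ "inv_into UNIV p"]) (auto simp: perm_group_def permutes_inv permutes_inv_o)
qed (auto simp: perm_group_def permutes_compose permutes_id comp_assoc)

lemma inv_perm_group: "p permutes S \<Longrightarrow> inv\<^bsub>perm_group S\<^esub> p = inv_into UNIV p"
  by (intro group.inv_equality[OF group_perm_group])
    (auto simp: perm_group_def permutes_inv permutes_inv_o)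

declare eval_letter.simps [simp del]

lemma eval_letter_perm_group:
  assumes "\<And>x. p x permutes S"
  shows "eval_letter (perm_group S) p (x, True) = p x"
    and "eval_letter (perm_group S) p (x, False) = inv_into UNIV (p x)"
    and "eval_letter (perm_group S) p a permutes S"
  using assms by (cases a; auto simp: eval_letter.simps inv_perm_group permutes_inv)+

lemma eval_word_perm_group:
  "eval_word (perm_group S) p [] = id"
  "eval_word (perm_group S) p (a # w) = eval_letter (perm_group S) p a \<circ> eval_word (perm_group S) p w"
  by (auto simp: eval_word_def perm_group_def)

lemma eval_word_permutes:
  "(\<And>x. p x permutes S) \<Longrightarrow> eval_word (perm_group S) p w permutes S"
  by (induction w)
    (auto simp: eval_word_perm_group permutes_id eval_letter_perm_group intro!: permutes_compose)

section \<open>Finite permutation groups in which short words act nontrivially\<close>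

lemma partial_injection_extends:
  assumes "finite P" and f: "inj_on f P"
  obtains s where "s permutes P" and "\<And>v. \<lbrakk>v \<in> P; f v \<in> P\<rbrakk> \<Longrightarrow> s v = f v"
proof -
  define A where "A = {v \<in> P. f v \<in> P}"
  have AP: "A \<subseteq> P" and fAP: "f ` A \<subseteq> P" by (auto simp: A_def)
  have fA: "inj_on f A" using f AP inj_on_subset by blast
  have "card (P - A) = card (P - f ` A)"
    using AP fAP \<open>finite P\<close> by (simp add: card_Diff_subset finite_subset card_image[OF fA])
  then obtain g where g: "bij_betw g (P - A) (P - f ` A)"
    using \<open>finite P\<close> by (meson finite_Diff finite_same_card_bij)
  define s where "s v = (if v \<in> A then f v else if v \<in> P then g v else v)" for v
  have "bij_betw s A (f ` A)"
    using fA by (auto simp: s_def bij_betw_def inj_on_def)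
  moreover have "bij_betw s (P - A) (P - f ` A)"
    using g by (subst bij_betw_cong[of _ _ g]) (auto simp: s_def)
  ultimately have "bij_betw s (A \<union> (P - A)) (f ` A \<union> (P - f ` A))"
    by (rule bij_betw_combine) auto
  moreover have "A \<union> (P - A) = P" "f ` A \<union> (P - f ` A) = P"
    using AP fAP by auto
  ultimately have "s permutes P"
    using AP by (intro bij_imp_permutes) (auto simp: s_def)
  then show ?thesis by (rule that) (auto simp: s_def A_def)
qed

text \<open>\<open>B\<close> is a ball in the Cayley tree. Left multiplication by a basis letter is
  a partial injection of \<open>B\<close>, and \<open>t\<close> extends it to a permutation. All
  suffixes of a word \<open>w\<close> in \<open>B\<close> lie in \<open>B\<close>, so
  \<open>w\<close> carries \<open>[]\<close> to \<open>w\<close> along the tree.\<close>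

lemma short_words_act_nontrivially:
  fixes X :: "'x set"
  assumes "finite X"
  obtains B :: "'x letter list set" and t where "finite B" "\<And>x. t x permutes B"
    "\<And>w. \<lbrakk>reduced w; w \<noteq> []; length w \<le> R; fst ` set w \<subseteq> X\<rbrakk> \<Longrightarrow> eval_word (perm_group B) t w \<noteq> id"
proof -
  define B where "B = {w :: 'x letter list. reduced w \<and> length w \<le> R \<and> fst ` set w \<subseteq> X}"
  have "finite {w :: 'x letter list. set w \<subseteq> X \<times> UNIV \<and> length w \<le> R}"
    using assms by (intro finite_lists_length_le) auto
  then have fin: "finite B"
    by (rule rev_finite_subset) (force simp: B_def)
  have inj: "inj_on (push a) B" for a :: "'x letter"
    by (rule inj_on_inverseI[of _ "push (inv_letter a)"]) (simp add: B_def push_inv)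
  have "\<exists>s. s permutes B \<and> (\<forall>v. v \<in> B \<longrightarrow> push (x, True) v \<in> B \<longrightarrow> s v = push (x, True) v)" for x
    by (rule partial_injection_extends[OF fin inj[of "(x, True)"]]) blast
  then obtain t where t: "\<And>x. t x permutes B"
    "\<And>x v. v \<in> B \<Longrightarrow> push (x, True) v \<in> B \<Longrightarrow> t x v = push (x, True) v"
    by metis
  have letter: "eval_letter (perm_group B) t a w = a # w" if "a # w \<in> B" for a w
  proof -
    have w: "w \<in> B" using that by (auto simp: B_def dest: reduced_tl)
    have red: "reduced (a # w)" using that by (simp add: B_def)
    obtain x b where a: "a = (x, b)" by (cases a)
    show ?thesis
    proof (cases b)
      case True
      then show ?thesis
        using t(2)[of w x] w that red a
        by (simp add: push_reduced eval_letter_perm_group[OF t(1)])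
    next
      case False
      \<comment> \<open>A negative letter is the positive edge read backwards: \<open>t x\<close>
        strips it from \<open>a # w\<close>.\<close>
      then have "push (x, True) (a # w) = w"
        using a by simp
      then have "t x (a # w) = w" using t(2)[of "a # w" x] w that by simp
      then have "inv_into UNIV (t x) w = a # w" using permutes_inverses(2)[OF t(1)] by metis
      then show ?thesis using a False
        by (simp add: eval_letter_perm_group[OF t(1)])
    qed
  qed
  have "eval_word (perm_group B) t w [] = w" if "w \<in> B" for w
    using that
  proof (induction w)
    case (Cons a w)
    then have "w \<in> B" by (auto simp: B_def dest: reduced_tl)
    then show ?case using Cons letter by (simp add: eval_word_perm_group)
  qed (simp add: eval_word_perm_group)
  then show ?thesis using fin t(1) by (intro that[of B t]) (fastforce simp: B_def)+
qed

lemma reduced_appendD: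
  assumes "reduced (u @ v)"
  shows "reduced u" "reduced v"
  using assms by (induction u rule: induct_list012) (auto dest: reduced_tl)

section \<open>Completing a finite partial action\<close>

text \<open>Words act from the left, so a path reads its word from right to left.\<close>

lemma finite_completion:
  fixes X :: "'x set" and P :: "'v set" and act :: "'x letter \<Rightarrow> 'v \<Rightarrow> 'v"
  assumes X: "finite X" and P: "finite P"
    and act_inv: "\<And>a v. \<lbrakk>fst a \<in> X; v \<in> P\<rbrakk> \<Longrightarrow> act (inv_letter a) (act a v) = v"
  obtains Y :: "('v + 'x \<times> 'v \<times> ('x letter list \<Rightarrow> 'x letter list)) set" and p
  where "finite Y" "\<And>x. p x permutes Y" "Inl ` P \<subseteq> Y"
    "\<And>a v. \<lbrakk>fst a \<in> X; v \<in> P; act a v \<in> P\<rbrakk> \<Longrightarrow> eval_letter (perm_group Y) p a (Inl v) = Inl (act a v)"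
    "\<And>w v z. \<lbrakk>reduced w; length w \<le> R; fst ` set w \<subseteq> X; v \<in> P; eval_word (perm_group Y) p w (Inl v) = Inl z\<rbrakk>
       \<Longrightarrow> z = foldr act w v"
    "\<And>w y. \<lbrakk>reduced w; w \<noteq> []; length w \<le> R; fst ` set w \<subseteq> X; y \<in> Y; eval_word (perm_group Y) p w y = y\<rbrakk>
       \<Longrightarrow> \<exists>u g v. w = u @ g \<and> v \<in> P \<and> eval_word (perm_group Y) p g y = Inl v"
proof -
  obtain B :: "'x letter list set" and t where B: "finite B" and t: "\<And>x. t x permutes B"
    and t_ne: "\<And>w. \<lbrakk>reduced w; w \<noteq> []; length w \<le> R; fst ` set w \<subseteq> X\<rbrakk> \<Longrightarrow> eval_word (perm_group B) t w \<noteq> id"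
    using short_words_act_nontrivially[OF X] by metis
  let ?tl = "eval_letter (perm_group B) t" and ?tw = "eval_word (perm_group B) t"
  define f where "f x = act (x, True)" for x
  have inj_f: "inj_on (f x) P" if "x \<in> X" for x
    by (rule inj_on_inverseI[of _ "act (x, False)"]) (use act_inv[of "(x, True)"] that in \<open>simp add: f_def\<close>)
  have "\<exists>s. s permutes P \<and> (\<forall>v. v \<in> P \<longrightarrow> f x v \<in> P \<longrightarrow> s v = f x v)" if "x \<in> X" for x
    by (rule partial_injection_extends[OF P inj_f[OF that]]) blast
  then obtain s where s: "\<And>x. x \<in> X \<Longrightarrow> s x permutes P"
    and s_eq: "\<And>x v. \<lbrakk>x \<in> X; v \<in> P; f x v \<in> P\<rbrakk> \<Longrightarrow> s x v = f x v"
    by metis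
  \<comment> \<open>On \<open>B\<close> a short nontrivial word may still fix points. Left
    multiplication on the group \<open>Q\<close> is free, so there such a word moves every point.
    Elements outside the subgroup generated by the \<open>t x\<close> only add components to the
    Cayley graph.\<close>
  define Q where "Q = {q. q permutes B}"
  have Q: "finite Q" "id \<in> Q" "\<And>x. t x \<in> Q" "\<And>x q. q \<in> Q \<Longrightarrow> t x \<circ> q \<in> Q"
    using B t by (auto simp: Q_def finite_permutations permutes_id permutes_compose)
  define Y :: "('v + 'x \<times> 'v \<times> ('x letter list \<Rightarrow> 'x letter list)) set"
    where "Y = P <+> X \<times> P \<times> Q"
  have Y: "finite Y" using X P Q by (simp add: Y_def)
  \<comment> \<open>The copy of \<open>Q\<close> labelled \<open>(x, v)\<close> is cut at its \<open>x\<close>-edge from \<open>id\<close> to \<open>t x\<close> if the \<open>x\<close>-edge at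
    \<open>v\<close> leaves \<open>P\<close>; otherwise it stays intact and disconnected from \<open>P\<close>. The permutation \<open>s x\<close>
    pairs the outgoing \<open>x\<close>-edges missing in \<open>P\<close> with the incoming ones.\<close>
  define p0 :: "'x \<Rightarrow> 'v + 'x \<times> 'v \<times> ('x letter list \<Rightarrow> 'x letter list) \<Rightarrow> _" where
    "p0 x y = (case y of Inl v \<Rightarrow> if f x v \<in> P then Inl (f x v) else Inr (x, v, t x)
       | Inr (x', v, q) \<Rightarrow> if x = x' \<and> q = id \<and> f x v \<notin> P then Inl (s x v) else Inr (x', v, t x \<circ> q))" for x y
  have p0_Inl: "p0 x (Inl v) = (if f x v \<in> P then Inl (f x v) else Inr (x, v, t x))" for x v
    by (simp add: p0_def)
  have p0_Inr: "p0 x (Inr (x', v, q)) =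
      (if x = x' \<and> q = id \<and> f x v \<notin> P then Inl (s x v) else Inr (x', v, t x \<circ> q))" for x x' v q
    by (simp add: p0_def)
  have p0_Y: "p0 x y \<in> Y" if "x \<in> X" "y \<in> Y" for x y
    using that Q s[of x] by (auto simp: Y_def p0_Inl p0_Inr permutes_in_image)
  have t_cancel: "t x \<circ> q = t x \<circ> q' \<longleftrightarrow> q = q'" "t x = t x \<circ> q \<longleftrightarrow> q = id" "t x \<circ> q = t x \<longleftrightarrow> q = id" for x q q'
  proof -
    show *: "t x \<circ> q = t x \<circ> q' \<longleftrightarrow> q = q'" for q q'
      using permutes_inv_o(2)[OF t] by (metis comp_assoc id_comp)
    show "t x = t x \<circ> q \<longleftrightarrow> q = id" "t x \<circ> q = t x \<longleftrightarrow> q = id"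
      using *[of q id] *[of id q] by auto
  qed
  \<comment> \<open>An edge inside \<open>P\<close> and an edge returning from a copy never end at
    the same vertex: both follow the permutation \<open>s x\<close>, from different sources.\<close>
  have s_f: "f x v' \<noteq> s x v" if "x \<in> X" "v \<in> P" "v' \<in> P" "f x v' \<in> P" "f x v \<notin> P" for x v v'
  proof
    assume "f x v' = s x v"
    then have "s x v = s x v'" using s_eq that by simp
    then have "v = v'" using permutes_inj[OF s[OF that(1)]] by (auto dest: injD)
    then show False using that by simp
  qed
  have "inj_on (p0 x) Y" if x: "x \<in> X" for x
  proof (rule inj_onI)
    \<comment> \<open>Images in \<open>P\<close> differ by \<open>s_f\<close>. In a copy, the vertex
      \<open>t x\<close> entered from \<open>P\<close> could be hit from inside only at
      \<open>id\<close>, where the edge has been cut.\<close>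
    have mixed: "p0 x (Inl v) \<noteq> p0 x (Inr c)" if "Inl v \<in> Y" "Inr c \<in> Y" for v c
      using that s_f[OF x] by (cases c) (auto simp: Y_def p0_Inl p0_Inr t_cancel)
    fix y y' assume y: "y \<in> Y" "y' \<in> Y" and eq: "p0 x y = p0 x y'"
    show "y = y'"
    proof (cases y)
      case (Inl v)
      then obtain v' where "y' = Inl v'" using mixed y eq by (cases y') auto
      then show ?thesis
        using Inl y eq inj_onD[OF inj_f[OF x]] by (auto simp: Y_def p0_Inl split: if_splits)
    next
      case (Inr c)
      then obtain c' where "y' = Inr c'" using mixed y eq[symmetric] by (cases y') auto
      then show ?thesis
        using Inr y eq injD[OF permutes_inj[OF s[OF x]]]
        by (cases c; cases c') (auto simp: p0_Inr t_cancel split: if_splits)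
    qed
  qed
  \<comment> \<open>A letter outside \<open>X\<close> may act by any permutation of
    \<open>Y\<close>, such as the identity.\<close>
  then have "\<exists>p. p permutes Y \<and> (x \<in> X \<longrightarrow> (\<forall>y \<in> Y. p y = p0 x y))" for x
    using partial_injection_extends[OF Y, of "p0 x"] p0_Y[of x] permutes_id[of Y] by metis
  then obtain p where p: "\<And>x. p x permutes Y" and p_eq: "\<And>x y. \<lbrakk>x \<in> X; y \<in> Y\<rbrakk> \<Longrightarrow> p x y = p0 x y"
    by metis
  let ?pl = "eval_letter (perm_group Y) p" and ?pw = "eval_word (perm_group Y) p"
  note letter = eval_letter_perm_group(1,2)[OF p] eval_letter_perm_group(1,2)[OF t]
  have inv_p: "inv_into UNIV (p x) z = y" if "x \<in> X" "y \<in> Y" "p0 x y = z" for x y z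
    using that p_eq[of x y] permutes_inverses(2)[OF p] by metis
  have PY: "Inl ` P \<subseteq> Y" by (auto simp: Y_def)
  have in_P: "?pl a (Inl v) = Inl (act a v)" if "fst a \<in> X" "v \<in> P" "act a v \<in> P" for a v
  proof -
    obtain x b where a: "a = (x, b)" by (cases a)
    show ?thesis
    proof (cases b)
      case True
      have "p x (Inl v) = p0 x (Inl v)" using that a by (intro p_eq) (auto simp: Y_def)
      then show ?thesis using that a True
        by (simp add: letter f_def p0_Inl)
    next
      case False
      then have "f x (act a v) = v" using act_inv[of a v] that a by (simp add: f_def)
      then have "inv_into UNIV (p x) (Inl v) = Inl (act a v)"
        using that a by (intro inv_p) (auto simp: p0_Inl Y_def)
      then show ?thesis using a False by (simp add: letter)
    qed
  qed
  have leave_P: "\<exists>v' \<in> P. ?pl a (Inl v) = Inr (fst a, v', if snd a then ?tl a else id)"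
    if "fst a \<in> X" "v \<in> P" "act a v \<notin> P" for a v
  proof -
    obtain x b where a: "a = (x, b)" by (cases a)
    show ?thesis
    proof (cases b)
      case True
      have "p x (Inl v) = p0 x (Inl v)" using that a by (intro p_eq) (auto simp: Y_def)
      then show ?thesis using that a True by (auto simp: letter f_def p0_Inl)
    next
      case False
      \<comment> \<open>Read backwards, the \<open>x\<close>-edge into \<open>v\<close> comes from
        the copy labelled by the preimage of \<open>v\<close> under \<open>s x\<close>. That copy is
        cut, since otherwise \<open>act a v\<close> would be \<open>v'\<close> and lie in
        \<open>P\<close>.\<close>
      obtain v' where v': "v' \<in> P" "s x v' = v"
        using permutes_image[OF s[of x]] \<open>fst a \<in> X\<close> \<open>v \<in> P\<close> a by (metis fst_conv imageE)
      have "f x v' \<notin> P"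
      proof
        assume "f x v' \<in> P"
        then have "f x v' = v" using s_eq v' that a by simp
        then have "act a v = v'" using act_inv[of "(x, True)" v'] that a False v' by (simp add: f_def)
        then show False using that v' by simp
      qed
      then have "inv_into UNIV (p x) (Inl v) = Inr (x, v', id)"
        using that a v' Q by (intro inv_p) (auto simp: p0_Inr Y_def)
      then show ?thesis using a False v' by (auto simp: letter)
    qed
  qed
  \<comment> \<open>The exits are the two ends of the cut edge: \<open>x'\<close> read at
    \<open>id\<close>, or its inverse read at \<open>t x'\<close>. The latter is expressed as a
    product equal to \<open>id\<close>, the form that \<open>t_ne\<close> refutes.\<close>
  have copy: "?pl a (Inr (x', v, q)) = Inr (x', v, ?tl a \<circ> q) \<or>
      (\<exists>v' \<in> P. ?pl a (Inr (x', v, q)) = Inl v') \<and>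
       (a = (x', True) \<and> q = id \<or> a = (x', False) \<and> ?tl a \<circ> q = id)"
    if "fst a \<in> X" "Inr (x', v, q) \<in> Y" for a x' v q
  proof -
    obtain x b where a: "a = (x, b)" by (cases a)
    have x: "x \<in> X" using that a by simp
    have q: "q permutes B" "v \<in> P" "x' \<in> X" using that by (auto simp: Y_def Q_def)
    show ?thesis
    proof (cases b)
      case True
      then show ?thesis using that a x p_eq[of x "Inr (x', v, q)"] q s[of x]
        by (auto simp: letter p0_Inr permutes_in_image)
    next
      case False
      let ?q = "inv_into UNIV (t x) \<circ> q"
      have tq: "t x \<circ> ?q = q"
        using permutes_inv_o(1)[OF t[of x]] by (simp add: comp_assoc[symmetric])
      have Yq: "Inr (x', v, ?q) \<in> Y"
        using q t by (auto simp: Y_def Q_def permutes_inv permutes_compose)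
      show ?thesis
      proof (cases "x = x' \<and> ?q = id \<and> f x v \<notin> P")
        case True
        then have "inv_into UNIV (p x) (Inr (x', v, q)) = Inl v"
          using tq x q by (intro inv_p) (auto simp: p0_Inl Y_def)
        then show ?thesis using True a False q by (auto simp: letter)
      next
        case out: False
        have "inv_into UNIV (p x) (Inr (x', v, q)) = Inr (x', v, ?q)"
          using tq x Yq out by (intro inv_p) (simp_all only: p0_Inr if_False)
        then show ?thesis using a False by (simp add: letter)
      qed
    qed
  qed
  have pw_Y: "?pw w y \<in> Y" if "y \<in> Y" for w y
    by (simp add: permutes_in_image[OF eval_word_permutes] p that)
  \<comment> \<open>A path entering a copy starts at \<open>t x\<close> (first letter of \<open>u\<close> read inside) or, coming backwards,
    at \<open>id\<close> with \<open>u\<close> empty; reducedness excludes turning back, and the girth any later exit.\<close>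
  have path: "?pw w (Inl v) = Inl (foldr act w v) \<and> foldr act w v \<in> P \<or>
      (\<exists>u r x v'. w = u @ r \<and> (u = [] \<longrightarrow> hd w = (x, False) \<and> w \<noteq> []) \<and> ?pw w (Inl v) = Inr (x, v', ?tw u))"
    if "reduced w" "length w \<le> R" "fst ` set w \<subseteq> X" "v \<in> P" for w v
    using that
  proof (induction w)
    case Nil
    then show ?case by (simp add: eval_word_perm_group)
  next
    case (Cons a w)
    have a: "fst a \<in> X" and w: "reduced w" "length w \<le> R" "fst ` set w \<subseteq> X"
      using Cons.prems by (auto dest: reduced_tl)
    consider "?pw w (Inl v) = Inl (foldr act w v)" "foldr act w v \<in> P"
      | u r x v' where "w = u @ r" "u = [] \<Longrightarrow> hd w = (x, False) \<and> w \<noteq> []" "?pw w (Inl v) = Inr (x, v', ?tw u)"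
      using Cons.IH[OF w Cons.prems(4)] by blast
    then show ?case
    proof cases
      case 1
      show ?thesis
      proof (cases "act a (foldr act w v) \<in> P")
        case True
        then show ?thesis using 1 in_P[OF a] by (simp add: eval_word_perm_group)
      next
        case False
        then obtain v' where "?pw (a # w) (Inl v) = Inr (fst a, v', if snd a then ?tl a else id)"
          using leave_P[OF a 1(2)] 1 by (auto simp: eval_word_perm_group)
        then have "?pw (a # w) (Inl v) = Inr (fst a, v', ?tw (if snd a then [a] else []))"
          by (simp add: eval_word_perm_group)
        then show ?thesis
          by (intro disjI2 exI[of _ "if snd a then [a] else []"] exI[of _ "if snd a then w else a # w"]
              exI[of _ "fst a"] exI[of _ v']) (auto simp: prod_eq_iff)
      qed
    next
      case 2
      have y: "Inr (x, v', ?tw u) \<in> Y" using pw_Y[of "Inl v" w] 2 PY Cons.prems by auto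
      have u: "reduced (a # u)" "length (a # u) \<le> R" "fst ` set (a # u) \<subseteq> X"
        using Cons.prems 2(1) reduced_appendD(1)[of "a # u" r] by auto
      \<comment> \<open>A forward exit needs \<open>u\<close> to act trivially, hence to be empty.
        The copy was then entered by \<open>(x, False)\<close>, and reading \<open>(x, True)\<close>
        next would be a cancellation.\<close>
      have False if "a = (x, True)" "?tw u = id"
      proof -
        have "u = []" using t_ne[of u] u that by (auto dest: reduced_tl)
        then show False using 2(2) Cons.prems that by (cases w) auto
      qed
      \<comment> \<open>A backward exit would make the short nonempty reduced word
        \<open>a # u\<close> act trivially on \<open>B\<close>.\<close>
      moreover have "?tl a \<circ> ?tw u \<noteq> id"
        using t_ne[of "a # u"] u by (simp add: eval_word_perm_group)
      ultimately have "?pl a (Inr (x, v', ?tw u)) = Inr (x, v', ?tl a \<circ> ?tw u)"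
        using copy[OF a y] by blast
      then have "?pw (a # w) (Inl v) = Inr (x, v', ?tw (a # u))"
        using 2 by (simp add: eval_word_perm_group)
      then show ?thesis using 2(1) by (metis append_Cons list.distinct(1))
    qed
  qed
  \<comment> \<open>Until some suffix \<open>g\<close> reaches \<open>P\<close>, the word only
    multiplies the copy coordinate from the left.\<close>
  have exits: "(\<exists>u g z. w = u @ g \<and> z \<in> P \<and> ?pw g (Inr (x, v, q)) = Inl z) \<or>
      ?pw w (Inr (x, v, q)) = Inr (x, v, ?tw w \<circ> q)"
    if "Inr (x, v, q) \<in> Y" "fst ` set w \<subseteq> X" for w x v q
    using that
  proof (induction w)
    case (Cons a w)
    have "fst ` set w \<subseteq> X" using Cons.prems by simp
    then consider u g z where "w = u @ g" "z \<in> P" "?pw g (Inr (x, v, q)) = Inl z"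
      | "?pw w (Inr (x, v, q)) = Inr (x, v, ?tw w \<circ> q)" 
      using Cons.IH[OF Cons.prems(1)] by blast
    then show ?case
    proof cases
      case 1
      then show ?thesis by (metis append_Cons)
    next
      case 2
      then have "Inr (x, v, ?tw w \<circ> q) \<in> Y" using pw_Y[OF Cons.prems(1), of w] by simp
      then consider "?pl a (Inr (x, v, ?tw w \<circ> q)) = Inr (x, v, ?tl a \<circ> (?tw w \<circ> q))"
        | z where "z \<in> P" "?pl a (Inr (x, v, ?tw w \<circ> q)) = Inl z"
        using copy[of a x v "?tw w \<circ> q"] Cons.prems by auto
      then show ?thesis
      proof cases
        case 1
        then have "?pw (a # w) (Inr (x, v, q)) = Inr (x, v, ?tw (a # w) \<circ> q)"
          by (simp only: eval_word_perm_group comp_apply 2 comp_assoc)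
        then show ?thesis by blast
      next
        case z: 2
        then have "?pw (a # w) (Inr (x, v, q)) = Inl z" using 2 by (simp add: eval_word_perm_group)
        then show ?thesis using z(1) by (metis append_Nil)
      qed
    qed
  qed (simp add: eval_word_perm_group)
  show ?thesis
  proof (rule that[OF Y p PY in_P])
    show "z = foldr act w v"
      if "reduced w" "length w \<le> R" "fst ` set w \<subseteq> X" "v \<in> P" "?pw w (Inl v) = Inl z" for w v z
      using path[OF that(1-4)] that(5) by auto
    fix w y
    assume w: "reduced w" "w \<noteq> []" "length w \<le> R" "fst ` set w \<subseteq> X" and y: "y \<in> Y" "?pw w y = y"
    show "\<exists>u g v. w = u @ g \<and> v \<in> P \<and> ?pw g y = Inl v"
    proof (cases y)
      case (Inl v)
      then show ?thesis using y by (intro exI[of _ w] exI[of _ "[]"]) (auto simp: eval_word_perm_group Y_def)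
    next
      case (Inr c)
      obtain x v q where c: "y = Inr (x, v, q)" using Inr by (cases c) auto
      \<comment> \<open>Cancelling \<open>q\<close> would leave a short nontrivial word acting
        trivially on \<open>B\<close>.\<close>
      have "?tw w \<circ> q \<noteq> q"
      proof
        assume "?tw w \<circ> q = q"
        moreover have "q permutes B" using y c by (auto simp: Y_def Q_def)
        ultimately have "?tw w = id" by (metis comp_assoc comp_id permutes_inv_o(1))
        then show False using t_ne w by blast
      qed
      then show ?thesis using exits[of x v q w] y w c by auto
    qed
  qed
qed

section \<open>Separability\<close>

lemma generate_fixes:
  assumes "group_hom G (perm_group Y) \<phi>" and "S \<subseteq> carrier G" and S: "\<And>s. s \<in> S \<Longrightarrow> \<phi> s y = y"
    and "h \<in> generate G S"
  shows "\<phi> h y = y"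
proof -
  interpret group_hom G "perm_group Y" \<phi> by fact
  have inv_fix: "\<phi> (inv\<^bsub>G\<^esub> s) y = y" if "s \<in> carrier G" "\<phi> s y = y" for s
  proof -
    have "\<phi> s permutes Y" using hom_closed[OF that(1)] by (simp add: perm_group_def)
    then show ?thesis
      using that by (simp add: inv_perm_group permutes_inv_eq)
  qed
  show ?thesis
    using assms(4)
  proof (induction rule: generate.induct)
    case one
    then show ?case using hom_one by (simp add: perm_group_def)
  next
    case (incl s)
    then show ?case by (rule S)
  next
    case (inv s)
    then show ?case using S inv_fix assms(2) by blast
  next
    case (eng s t)
    then have "s \<in> carrier G" "t \<in> carrier G"
      using G.generate_in_carrier[OF assms(2)] by auto
    then show ?case using eng by (simp add: perm_group_def)
  qed
qed

text \<open>Conjugation by \<open>k\<close> is multiplicative and \<open>H\<close> is a subgroup.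
  Testing generators alone keeps the words to be examined of bounded length.\<close>

lemma conjugate_into_generateI:
  fixes G (structure)
  assumes "group G" "subgroup H G" "S \<subseteq> carrier G" "k \<in> carrier G"
    and S: "\<And>s. s \<in> S \<Longrightarrow> inv k \<otimes> s \<otimes> k \<in> H"
  shows "conjugate_into G (generate G S) H"
proof -
  interpret group G by fact
  interpret H: subgroup H G by fact
  have k: "k \<otimes> (inv k \<otimes> z) = z" if "z \<in> carrier G" for z
    using that assms(4) by (simp flip: m_assoc)
  have gen: "s \<in> carrier G" if "s \<in> generate G S" for s
    using generate_in_carrier[OF assms(3)] that by blast
  have "inv k \<otimes> s \<otimes> k \<in> H" if "s \<in> generate G S" for s
    using that
  proof (induction rule: generate.induct)
    case (inv s)
    then have "inv k \<otimes> inv s \<otimes> k = inv (inv k \<otimes> s \<otimes> k)"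
      using assms(3,4) by (subst inv_mult_group inv_mult_group; auto simp: inv_mult_group m_assoc)
    then show ?case using S[OF inv] H.m_inv_closed by simp
  next
    case (eng s t)
    have "inv k \<otimes> (s \<otimes> t) \<otimes> k = (inv k \<otimes> s \<otimes> k) \<otimes> (inv k \<otimes> t \<otimes> k)"
      using gen[OF eng.hyps(1)] gen[OF eng.hyps(2)] assms(4) by (simp add: m_assoc k)
    then show ?case using eng.IH by simp
  qed (use S assms(4) in auto)
  then show ?thesis
    using assms(4) by (auto simp: conjugate_into_def conj_set_def l_coset_def r_coset_def)
qed

section \<open>Invariance of separability under isomorphism\<close>

lemma separable_iso:
  assumes "group F" "group G" and h: "h \<in> iso F G" and sep: "subgroup_into_conjugacy_separable G"
  shows "subgroup_into_conjugacy_separable F"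
  unfolding subgroup_into_conjugacy_separable_def
proof (intro allI impI, elim conjE)
  fix H\<^sub>1 H\<^sub>2
  assume H: "subgroup H\<^sub>1 F" "fin_gen_subgroup F H\<^sub>1" "subgroup H\<^sub>2 F" "fin_gen_subgroup F H\<^sub>2"
    and nc: "\<not> conjugate_into F H\<^sub>2 H\<^sub>1"
  have hom: "h \<in> hom F G" and bij: "bij_betw h (carrier F) (carrier G)"
    using h by (auto simp: iso_def)
  interpret group_hom F G h
    by (intro group_hom.intro group_hom_axioms.intro assms hom)
  have fg: "fin_gen_subgroup G (h ` A)" if A: "fin_gen_subgroup F A" for A
  proof -
    obtain S where S: "finite S" "S \<subseteq> carrier F" "A = generate F S"
      using A by (auto simp: fin_gen_subgroup_def)
    then show ?thesis
      using generate_img[OF S(2)] by (intro fin_gen_subgroup_def[THEN iffD2] exI[of _ "h ` S"]) auto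
  qed
  have "\<not> conjugate_into G (h ` H\<^sub>2) (h ` H\<^sub>1)"
  proof
    assume "conjugate_into G (h ` H\<^sub>2) (h ` H\<^sub>1)"
    then obtain k' where "k' \<in> carrier G" "conj_set G (h ` H\<^sub>2) k' \<subseteq> h ` H\<^sub>1"
      by (auto simp: conjugate_into_def)
    then obtain k where k: "k \<in> carrier F" and sub: "conj_set G (h ` H\<^sub>2) (h k) \<subseteq> h ` H\<^sub>1"
      using bij by (metis bij_betw_imp_surj_on imageE)
    have "conj_set F H\<^sub>2 k \<subseteq> H\<^sub>1"
    proof
      fix z assume "z \<in> conj_set F H\<^sub>2 k"
      then obtain a where a: "a \<in> H\<^sub>2" "z = inv\<^bsub>F\<^esub> k \<otimes>\<^bsub>F\<^esub> a \<otimes>\<^bsub>F\<^esub> k"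
        by (auto simp: conj_set_def l_coset_def r_coset_def)
      then have ac: "a \<in> carrier F" using H(3) subgroup.mem_carrier by metis
      then have "h z \<in> conj_set G (h ` H\<^sub>2) (h k)"
        using a k by (auto simp: conj_set_def l_coset_def r_coset_def)
      then obtain b where b: "b \<in> H\<^sub>1" "h z = h b" using sub by auto
      moreover have "b \<in> carrier F" "z \<in> carrier F"
        using b H(1) subgroup.mem_carrier a ac k by auto
      ultimately show "z \<in> H\<^sub>1" using bij by (metis bij_betw_imp_inj_on inj_onD)
    qed
    then show False using nc k by (auto simp: conjugate_into_def)
  qed
  moreover have "subgroup (h ` H\<^sub>1) G" "subgroup (h ` H\<^sub>2) G"
    using H subgroup_img_is_subgroup by auto
  ultimately obtain Q :: "nat monoid" and \<phi> where "group Q" "finite (carrier Q)" "\<phi> \<in> hom G Q"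
    "\<not> conjugate_into Q (\<phi> ` h ` H\<^sub>2) (\<phi> ` h ` H\<^sub>1)"
    using sep fg H unfolding subgroup_into_conjugacy_separable_def by metis
  then show "\<exists>(Q :: nat monoid) \<phi>. group Q \<and> finite (carrier Q) \<and> \<phi> \<in> hom F Q
      \<and> \<not> conjugate_into Q (\<phi> ` H\<^sub>2) (\<phi> ` H\<^sub>1)"
    using Group.hom_compose[OF hom, of \<phi> Q] unfolding image_comp by blast
qed

section \<open>Word lengths, and separability of \<open>free_group X\<close>\<close>

lemma length_push: "length (push a w) \<le> Suc (length w)"
  by (cases w) auto

lemma length_foldr_push: "length (foldr push u v) \<le> length u + length v"
proof (induction u)
  case (Cons a u)
  then show ?case using length_push[of a "foldr push u v"] by simp
qed simp

text \<open>This form bounds the length and the letters of an inverse by those of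
  \<open>w\<close>.\<close>

lemma inv_free_group:
  assumes "w \<in> carrier (free_group X)"
  shows "inv\<^bsub>free_group X\<^esub> w = foldr push (map inv_letter (rev w)) []"
proof (rule group.inv_equality[OF group_free_group])
  show "foldr push (map inv_letter (rev w)) [] \<otimes>\<^bsub>free_group X\<^esub> w = \<one>\<^bsub>free_group X\<^esub>"
    using assms foldr_inverse[of "[]" w] by (simp add: free_group_def foldr_foldr foldr_Nil)
  show "foldr push (map inv_letter (rev w)) [] \<in> carrier (free_group X)"
    using assms set_foldr[of "map inv_letter (rev w)" "[]"]
    by (force simp: free_group_def reduced_foldr)
qed (rule assms)

theorem free_group_separable:
  fixes X :: "'x set"
  shows "subgroup_into_conjugacy_separable (free_group X)"
  unfolding subgroup_into_conjugacy_separable_def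
proof (intro allI impI, elim conjE)
  let ?F = "free_group X"
  interpret F: group ?F by (rule group_free_group)
  fix H\<^sub>1 H\<^sub>2
  assume H: "subgroup H\<^sub>1 ?F" "fin_gen_subgroup ?F H\<^sub>1" "subgroup H\<^sub>2 ?F" "fin_gen_subgroup ?F H\<^sub>2"
    and nc: "\<not> conjugate_into ?F H\<^sub>2 H\<^sub>1"
  interpret H1: subgroup H\<^sub>1 ?F by (rule H)
  obtain S\<^sub>1 where S1: "finite S\<^sub>1" "S\<^sub>1 \<subseteq> carrier ?F" "H\<^sub>1 = generate ?F S\<^sub>1"
    using H by (auto simp: fin_gen_subgroup_def)
  obtain S\<^sub>2 where S2: "finite S\<^sub>2" "S\<^sub>2 \<subseteq> carrier ?F" "H\<^sub>2 = generate ?F S\<^sub>2"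
    using H by (auto simp: fin_gen_subgroup_def)
  \<comment> \<open>The basis may be infinite, but only finitely many of its elements occur in the
    generators, and the completion is built over these.\<close>
  define X0 where "X0 = fst ` \<Union> (set ` (S\<^sub>1 \<union> S\<^sub>2))"
  have X0: "finite X0" using S1 S2 by (simp add: X0_def)
  have in_X0: "fst ` set s \<subseteq> X0" if "s \<in> S\<^sub>1 \<union> S\<^sub>2" for s
    using that by (auto simp: X0_def)
  have red: "reduced w" if "w \<in> carrier ?F" for w using that by (simp add: free_group_def)
  have mult: "u \<otimes>\<^bsub>?F\<^esub> v = foldr push u v" and one: "\<one>\<^bsub>?F\<^esub> = []" for u v
    by (simp_all add: free_group_def)
  \<comment> \<open>If all generators were trivial, \<open>H\<^sub>2\<close> would be trivial and so
    conjugate into \<open>H\<^sub>1\<close>.\<close>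
  obtain w0 where w0: "w0 \<in> S\<^sub>2" "w0 \<noteq> []"
  proof (rule ccontr)
    assume "\<not> thesis"
    then have "\<And>s. s \<in> S\<^sub>2 \<Longrightarrow> s = \<one>\<^bsub>?F\<^esub>" using that one by auto
    then have "inv\<^bsub>?F\<^esub> \<one>\<^bsub>?F\<^esub> \<otimes>\<^bsub>?F\<^esub> s \<otimes>\<^bsub>?F\<^esub> \<one>\<^bsub>?F\<^esub> \<in> H\<^sub>1" if "s \<in> S\<^sub>2" for s
      using H1.one_closed F.inv_one F.r_one[OF F.one_closed] that by metis
    then have "conjugate_into ?F (generate ?F S\<^sub>2) H\<^sub>1"
      by (rule conjugate_into_generateI[OF F.group_axioms H(1) S2(2) F.one_closed])
    then show False using nc S2 by simp
  qed
  obtain K where K: "\<And>s. s \<in> S\<^sub>2 \<Longrightarrow> length s \<le> K"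
    using S2(1) by (metis finite_imageI finite_nat_set_iff_bounded_le imageI)
  \<comment> \<open>On left cosets of \<open>H\<^sub>1\<close> this is the Schreier graph:
    \<open>foldr act w v\<close> is the translate of \<open>v\<close> by \<open>w\<close>.\<close>
  define act :: "'x letter \<Rightarrow> 'x letter list set \<Rightarrow> 'x letter list set" where "act a v = push a ` v" for a v
  have foldr_act: "foldr act w v = w <#\<^bsub>?F\<^esub> v" for w v
    by (induction w) (auto simp: act_def l_coset_def mult)
  \<comment> \<open>Reading a generator from the right visits the cosets of its suffixes. Inserting
    \<open>H\<^sub>1\<close> covers an empty \<open>S\<^sub>1\<close>.\<close>
  define P where "P = insert H\<^sub>1 (\<Union>s \<in> S\<^sub>1. (\<lambda>n. foldr act (drop n s) H\<^sub>1) ` {..length s})"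
  have P: "finite P" using S1 by (simp add: P_def)
  have H1P: "H\<^sub>1 \<in> P" by (simp add: P_def)
  have suffix_P: "foldr act u H\<^sub>1 \<in> P" if "r @ u \<in> S\<^sub>1" for r u
    using that by (force simp: P_def intro!: rev_bexI[OF that] image_eqI[of _ _ "length r"])
  have P_coset: "\<exists>c \<in> carrier ?F. v = c <#\<^bsub>?F\<^esub> H\<^sub>1" if "v \<in> P" for v
  proof (cases "v = H\<^sub>1")
    case True
    then show ?thesis
      using F.lcos_mult_one[OF H1.subset] by (metis F.one_closed)
  next
    case False
    then obtain s n where s: "s \<in> S\<^sub>1" "v = foldr act (drop n s) H\<^sub>1"
      using False \<open>v \<in> P\<close> by (auto simp: P_def)
    then have "drop n s \<in> carrier ?F"
      using S1 reduced_appendD(2)[of "take n s" "drop n s"] set_drop_subset[of n s]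
      by (force simp: free_group_def)
    then show ?thesis using s foldr_act by blast
  qed
  have P_sub: "v \<subseteq> carrier ?F" if "v \<in> P" for v
    using P_coset[OF that] F.l_coset_subset_G[OF H1.subset] by blast
  have act_inv: "act (inv_letter a) (act a v) = v" if "fst a \<in> X0" "v \<in> P" for a v
  proof -
    have "push (inv_letter a) (push a w) = w" if "w \<in> v" for w
      using that P_sub[OF \<open>v \<in> P\<close>] red by (auto intro: push_inv)
    then show ?thesis by (simp add: act_def image_image)
  qed
  \<comment> \<open>The bound \<open>3 * K\<close> allows for a product of a suffix of
    \<open>w0\<close>, a generator of \<open>H\<^sub>2\<close> and the inverse of that
    suffix.\<close>
  obtain Y :: "('x letter list set + 'x \<times> 'x letter list set \<times> ('x letter list \<Rightarrow> 'x letter list)) set" and p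
    where Y: "finite Y" and p: "\<And>x. p x permutes Y" and PY: "Inl ` P \<subseteq> Y"
      and in_P: "\<And>a v. \<lbrakk>fst a \<in> X0; v \<in> P; act a v \<in> P\<rbrakk> \<Longrightarrow>
        eval_letter (perm_group Y) p a (Inl v) = Inl (act a v)"
      and path: "\<And>w v z. \<lbrakk>reduced w; length w \<le> 3 * K; fst ` set w \<subseteq> X0; v \<in> P;
        eval_word (perm_group Y) p w (Inl v) = Inl z\<rbrakk> \<Longrightarrow> z = foldr act w v"
      and exits: "\<And>w y. \<lbrakk>reduced w; w \<noteq> []; length w \<le> 3 * K; fst ` set w \<subseteq> X0; y \<in> Y;
        eval_word (perm_group Y) p w y = y\<rbrakk> \<Longrightarrow>
        \<exists>u g v. w = u @ g \<and> v \<in> P \<and> eval_word (perm_group Y) p g y = Inl v"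
    using finite_completion[where X = X0 and P = P and act = act and R = "3 * K", OF X0 P act_inv] by blast
  define \<phi> where "\<phi> = eval_word (perm_group Y) p"
  interpret \<phi>: group_hom ?F "perm_group Y" \<phi>
    unfolding \<phi>_def
    by (intro group_hom.intro group_hom_axioms.intro group_perm_group F.group_axioms
        free_group_extension(1)) (auto simp: perm_group_def p)
  have \<phi>_mult: "\<phi> (u \<otimes>\<^bsub>?F\<^esub> v) y = \<phi> u (\<phi> v y)" if "u \<in> carrier ?F" "v \<in> carrier ?F" for u v y
    using that by (simp add: \<phi>.hom_mult) (simp add: perm_group_def)
  have fix1: "\<phi> h (Inl H\<^sub>1) = Inl H\<^sub>1" if "h \<in> H\<^sub>1" for h
  proof (rule generate_fixes[OF \<phi>.group_hom_axioms S1(2)])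
    show "h \<in> generate ?F S\<^sub>1" using that S1 by simp
    fix s assume s: "s \<in> S\<^sub>1"
    \<comment> \<open>All suffixes of \<open>s\<close> lead to points of \<open>P\<close>, so its
      path is traced inside \<open>P\<close>. It closes up because \<open>s\<close> lies in
      \<open>H\<^sub>1\<close>.\<close>
    have "\<phi> u (Inl H\<^sub>1) = Inl (foldr act u H\<^sub>1)" if "s = r @ u" for r u
      using that
    proof (induction u arbitrary: r)
      case (Cons a u)
      have "fst a \<in> X0" using in_X0[of s] s Cons.prems by auto
      then show ?case
        using Cons.IH[of "r @ [a]"] Cons.prems s in_P[of a "foldr act u H\<^sub>1"]
          suffix_P[of r "a # u"] suffix_P[of "r @ [a]" u]
        by (simp add: \<phi>_def eval_word_perm_group)
    qed (simp add: \<phi>_def eval_word_perm_group)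
    then have "\<phi> s (Inl H\<^sub>1) = Inl (s <#\<^bsub>?F\<^esub> H\<^sub>1)" by (simp add: foldr_act)
    moreover have "s <#\<^bsub>?F\<^esub> H\<^sub>1 = H\<^sub>1"
      using F.coset_join3 s S1 H generate.incl by (metis subsetD)
    ultimately show "\<phi> s (Inl H\<^sub>1) = Inl H\<^sub>1" by simp
  qed
  have "\<not> conjugate_into (perm_group Y) (\<phi> ` H\<^sub>2) (\<phi> ` H\<^sub>1)"
  proof
    assume "conjugate_into (perm_group Y) (\<phi> ` H\<^sub>2) (\<phi> ` H\<^sub>1)"
    then obtain k where k: "k permutes Y" and sub: "conj_set (perm_group Y) (\<phi> ` H\<^sub>2) k \<subseteq> \<phi> ` H\<^sub>1"
      by (auto simp: conjugate_into_def perm_group_def)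
    define y where "y = k (Inl H\<^sub>1)"
    have y: "y \<in> Y" using k PY H1P by (auto simp: y_def permutes_in_image)
    have fix_y: "\<phi> s y = y" if s: "s \<in> H\<^sub>2" for s
    proof -
      have "inv_into UNIV k \<circ> \<phi> s \<circ> k \<in> conj_set (perm_group Y) (\<phi> ` H\<^sub>2) k"
        using s k by (auto simp: conj_set_def l_coset_def r_coset_def inv_perm_group)
          (auto simp: perm_group_def)
      then obtain h where "h \<in> H\<^sub>1" "inv_into UNIV k \<circ> \<phi> s \<circ> k = \<phi> h" using sub by auto
      then have "inv_into UNIV k (\<phi> s y) = Inl H\<^sub>1"
        using fix1[of h] by (metis comp_apply y_def)
      then show ?thesis using permutes_inverses(1)[OF k] by (metis y_def)
    qed
    have S2H: "s \<in> H\<^sub>2" "s \<in> carrier ?F" if "s \<in> S\<^sub>2" for s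
      using that S2 generate.incl by auto
    \<comment> \<open>The path of the short nontrivial word \<open>w0\<close> from \<open>y\<close>
      back to \<open>y\<close> meets \<open>P\<close>, at the coset \<open>v\<close>.\<close>
    obtain u g v where g: "w0 = u @ g" "v \<in> P" "\<phi> g y = Inl v"
      using exits[of w0 y] w0 K[of w0] in_X0[of w0] red[OF S2H(2)[OF w0(1)]] y fix_y[OF S2H(1)[OF w0(1)]]
      unfolding \<phi>_def by fastforce
    have gF: "g \<in> carrier ?F"
      using S2H(2)[OF w0(1)] g(1) reduced_appendD(2)[of u g] by (auto simp: free_group_def)
    let ?g' = "inv\<^bsub>?F\<^esub> g"
    have gl: "length g \<le> K" "fst ` set g \<subseteq> X0"
      using g(1) K[of w0] in_X0[of w0] w0 by auto
    have g'l: "length ?g' \<le> K" "fst ` set ?g' \<subseteq> X0"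
      using gl length_foldr_push[of "map inv_letter (rev g)" "[]"] set_foldr[of "map inv_letter (rev g)" "[]"]
      unfolding inv_free_group[OF gF] by (auto, force)
    have "\<phi> ?g' (Inl v) = \<phi> (?g' \<otimes>\<^bsub>?F\<^esub> g) y"
      using \<phi>_mult[of ?g' g y] gF g(3) by simp
    also have "\<dots> = y" using gF \<phi>.hom_one by (simp add: perm_group_def)
    finally have g'v: "\<phi> ?g' (Inl v) = y" .
    obtain c where c: "c \<in> carrier ?F" "v = c <#\<^bsub>?F\<^esub> H\<^sub>1" using P_coset g(2) by blast
    have "conjugate_into ?F (generate ?F S\<^sub>2) H\<^sub>1"
    proof (rule conjugate_into_generateI[OF F.group_axioms H(1) S2(2)])
      show "?g' \<otimes>\<^bsub>?F\<^esub> c \<in> carrier ?F" using gF c by simp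
      fix s assume s: "s \<in> S\<^sub>2"
      note sF = S2H(2)[OF s]
      define w where "w = g \<otimes>\<^bsub>?F\<^esub> (s \<otimes>\<^bsub>?F\<^esub> ?g')"
      have wF: "w \<in> carrier ?F" using gF sF by (simp add: w_def)
      have "length w \<le> length g + (length s + length ?g')"
        unfolding w_def mult
        using length_foldr_push[of g "foldr push s ?g'"] length_foldr_push[of s ?g'] by linarith
      then have "length w \<le> 3 * K" using gl(1) g'l(1) K[OF s] by linarith
      moreover have "set w \<subseteq> set g \<union> (set s \<union> set ?g')"
        unfolding w_def mult using set_foldr[of g "foldr push s ?g'"] set_foldr[of s ?g'] by blast
      then have "fst ` set w \<subseteq> X0" using gl(2) g'l(2) in_X0[of s] s by blast
      moreover have "\<phi> w (Inl v) = Inl v"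
        using gF sF g'v g(3) fix_y[OF S2H(1)[OF s]] by (simp add: w_def \<phi>_mult del: \<phi>.hom_mult \<phi>.hom_inv)
      ultimately have "v = w <#\<^bsub>?F\<^esub> v"
        using path[of w v v] red[OF wF] g(2) by (simp add: \<phi>_def foldr_act)
      moreover have "c \<in> v" using c H1.one_closed by (force simp: l_coset_def)
      then have "w \<otimes>\<^bsub>?F\<^esub> c \<in> w <#\<^bsub>?F\<^esub> v" by (auto simp: l_coset_def)
      ultimately have "w \<otimes>\<^bsub>?F\<^esub> c \<in> c <#\<^bsub>?F\<^esub> H\<^sub>1" using c by metis
      then obtain h where h: "h \<in> H\<^sub>1" "w \<otimes>\<^bsub>?F\<^esub> c = c \<otimes>\<^bsub>?F\<^esub> h" by (auto simp: l_coset_def)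
      have "inv\<^bsub>?F\<^esub> (?g' \<otimes>\<^bsub>?F\<^esub> c) \<otimes>\<^bsub>?F\<^esub> s \<otimes>\<^bsub>?F\<^esub> (?g' \<otimes>\<^bsub>?F\<^esub> c) = inv\<^bsub>?F\<^esub> c \<otimes>\<^bsub>?F\<^esub> (w \<otimes>\<^bsub>?F\<^esub> c)"
        using gF sF c by (simp add: w_def F.inv_mult_group F.m_assoc)
      also have "\<dots> = h" using h c H1.mem_carrier by (simp flip: F.m_assoc)
      finally show "inv\<^bsub>?F\<^esub> (?g' \<otimes>\<^bsub>?F\<^esub> c) \<otimes>\<^bsub>?F\<^esub> s \<otimes>\<^bsub>?F\<^esub> (?g' \<otimes>\<^bsub>?F\<^esub> c) \<in> H\<^sub>1"
        using h by simp
    qed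
    then show False using nc S2 by simp
  qed
  moreover have "finite (carrier (perm_group Y))"
    using Y by (simp add: perm_group_def finite_permutations)
  ultimately show "\<exists>(Q :: nat monoid) \<phi>. group Q \<and> finite (carrier Q) \<and> \<phi> \<in> hom ?F Q
      \<and> \<not> conjugate_into Q (\<phi> ` H\<^sub>2) (\<phi> ` H\<^sub>1)"
    using subgroup.subset[OF H(1)] subgroup.subset[OF H(3)]
    by (intro finite_quotient_nat[OF group_perm_group _ \<phi>.homh])
qed

theorem theorem1p8:
  fixes F :: "('a, 'b) monoid_scheme"
  assumes "is_free_group F"
  shows "subgroup_into_conjugacy_separable F"
proof -
  obtain X :: "'a set" and h where "group F" "h \<in> iso F (free_group X)"
    using assms by (auto simp: is_free_group_def is_iso_def)
  then show ?thesis by (rule separable_iso[OF _ group_free_group _ free_group_separable])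
qed

end
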